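(* Let $k$ and $s$ be positive integers with $s\in\{\lceil k/2\rceil,\ldots,k-2\}$, and for $n\ge1$ let $b_n^{(k,s)}$ be the number of vertices of the polytope $P_{n,k,s}$. Then $$\lim_{n\to\infty}\frac1n\ln b_n^{(k,s)}=\ln\left(\frac{2(k-s)(k-s-1)}{k-\sqrt{k^2-4(k-s)(k-s-1)}}\right).$$
   Context: For positive integers $n,k,s$ let $K=s(n-1)+k$ and let $e_0,\ldots,e_{K-1}$ be the standard basis of $\mathbb{R}^{K}$. For $0\le i\le n-1$ let $\lambda_i=\{si,si+1,\ldots,si+k-1\}$ and $\Delta_{\lambda_i}=\operatorname{conv}\{e_j: j\in\lambda_i\}$. Then $P_{n,k,s}=\sum_{i=0}^{n-1}\Delta_{\lambda_i}$ (Minkowski sum). *)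

theory Defs
  imports "HOL-Analysis.Analysis" "HOL-Analysis.Finite_Function_Topology"
begin

text \<open>
  The ambient space \<open>\<real>\<^sup>K\<close> with \<open>K = s (n - 1) + k\<close> changes with \<open>n\<close>. All these spaces are
  realised as the coordinate subspaces of the real vector space \<open>nat \<Rightarrow>\<^sub>0 real\<close> of finitely
  supported sequences, \<open>\<real>\<^sup>K\<close> being the vectors supported in \<open>{..<K}\<close>. Convex hulls, Minkowski
  sums and extreme points do not depend on the surrounding space.
\<close>

definition coord_space :: "nat \<Rightarrow> (nat \<Rightarrow>\<^sub>0 real) set" where
  "coord_space K = {x. Poly_Mapping.keys x \<subseteq> {..<K}}"

definition std_basis :: "nat \<Rightarrow> (nat \<Rightarrow>\<^sub>0 real)" where
  "std_basis j = Poly_Mapping.single j 1"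

definition lam :: "nat \<Rightarrow> nat \<Rightarrow> nat \<Rightarrow> nat set" where
  "lam k s i = {s * i..<s * i + k}"

definition coord_simplex :: "nat set \<Rightarrow> (nat \<Rightarrow>\<^sub>0 real) set" where
  "coord_simplex J = convex hull (std_basis ` J)"

text \<open>
  Addition of sets is the Minkowski sum of \<^theory>\<open>HOL-Library.Set_Algebras\<close>, and so the big sum
  is the Minkowski sum of the simplices.
\<close>

definition P :: "nat \<Rightarrow> nat \<Rightarrow> nat \<Rightarrow> (nat \<Rightarrow>\<^sub>0 real) set" where
  "P n k s = (\<Sum>i<n. coord_simplex (lam k s i))"

definition num_vertices :: "nat \<Rightarrow> nat \<Rightarrow> nat \<Rightarrow> nat" where
  "num_vertices k s n = card {v. v extreme_point_of P n k s}"

lemma P_eq_sums: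
  "P n k s = {\<Sum>i<n. x i | x. \<forall>i<n. x i \<in> coord_simplex (lam k s i)}"
  unfolding P_def by (subst set_sum_alt) auto

lemma lookup_scaleR:
  fixes x :: "nat \<Rightarrow>\<^sub>0 real"
  shows "Poly_Mapping.lookup (u *\<^sub>R x) j = u * Poly_Mapping.lookup x j"
proof -
  have "finite {i. u *\<^sub>R Poly_Mapping.lookup x i \<noteq> 0}"
    by (rule finite_subset[OF _ finite_lookup[of x]]) auto
  then show ?thesis
    by (simp add: scaleR_poly_mapping_def Abs_poly_mapping_inverse)
qed

lemma convex_coord_space: "convex (coord_space K)"
proof (rule convexI)
  fix x y :: "nat \<Rightarrow>\<^sub>0 real" and u v :: real
  assume "x \<in> coord_space K" "y \<in> coord_space K"
  moreover have "Poly_Mapping.keys (u *\<^sub>R x + v *\<^sub>R y) \<subseteq>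
      Poly_Mapping.keys x \<union> Poly_Mapping.keys y"
  proof
    fix j assume "j \<in> Poly_Mapping.keys (u *\<^sub>R x + v *\<^sub>R y)"
    then have "u * Poly_Mapping.lookup x j + v * Poly_Mapping.lookup y j \<noteq> 0"
      by (simp add: in_keys_iff lookup_add lookup_scaleR)
    then show "j \<in> Poly_Mapping.keys x \<union> Poly_Mapping.keys y"
      by (cases "Poly_Mapping.lookup x j = 0") (simp_all add: in_keys_iff)
  qed
  ultimately show "u *\<^sub>R x + v *\<^sub>R y \<in> coord_space K"
    unfolding coord_space_def by blast
qed

lemma coord_simplex_subset:
  assumes "J \<subseteq> {..<K}"
  shows "coord_simplex J \<subseteq> coord_space K"
  unfolding coord_simplex_def
  by (rule hull_minimal)
    (use assms convex_coord_space in \<open>auto simp: std_basis_def coord_space_def\<close>)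

lemma P_subset_coord_space: "P n k s \<subseteq> coord_space (s * (n - 1) + k)"
proof
  fix v assume "v \<in> P n k s"
  then obtain x where v: "v = (\<Sum>i<n. x i)"
    and x: "\<forall>i<n. x i \<in> coord_simplex (lam k s i)"
    unfolding P_eq_sums by blast
  have "x i \<in> coord_space (s * (n - 1) + k)" if "i < n" for i
  proof -
    have "s * i \<le> s * (n - 1)" using that by (intro mult_le_mono2) linarith
    then have "lam k s i \<subseteq> {..<s * (n - 1) + k}"
      unfolding lam_def subset_iff atLeastLessThan_iff lessThan_iff by linarith
    from coord_simplex_subset[OF this] show ?thesis using x that by blast
  qed
  then have "Poly_Mapping.keys (x i) \<subseteq> {..<s * (n - 1) + k}" if "i < n" for i
    using that by (simp add: coord_space_def)
  then show "v \<in> coord_space (s * (n - 1) + k)"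
    using keys_sum[of x "{..<n}"] unfolding v coord_space_def by blast
qed

end

theory Submission
  imports Defs
begin

text \<open>
  As \<open>k \<le> 2 s\<close>, only consecutive intervals meet, in \<open>m = k - s\<close> elements. A vertex of the
  Minkowski sum comes from a choice of one element \<open>f i\<close> in each interval, and the choices that
  occur are those for which no two consecutive elements are distinct and both in the overlap.
  Appending one interval to such a choice gives
  \<open>b (n + 2) = k * b (n + 1) - m * (m - 1) * b n\<close>, and the growth rate is the larger root
  \<open>\<alpha>\<close> of \<open>x\<^sup>2 - k * x + m * (m - 1)\<close>. With \<open>\<beta>\<close> the smaller root, the argument of the
  logarithm in the theorem is \<open>\<alpha>\<close> written as \<open>m * (m - 1) / \<beta>\<close>.
\<close>

section \<open>Extreme points in real vector spaces\<close>

text \<open>The open half-space below \<open>c v\<close>, with \<open>v\<close> added, is still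
  convex. So it contains the hull, and no open segment between two of its points passes through
  \<open>v\<close>.\<close>

lemma extreme_point_of_convex_hull_strict_max:
  fixes c :: "'a::real_vector \<Rightarrow> real"
  assumes "linear c" "v \<in> S" and less: "\<And>x. x \<in> S \<Longrightarrow> x \<noteq> v \<Longrightarrow> c x < c v"
  shows "v extreme_point_of (convex hull S)"
proof -
  interpret linear c by fact
  let ?T = "insert v {x. c x < c v}"
  have comb: "c ((1 - u) *\<^sub>R a + u *\<^sub>R b) < c v"
    if "a \<in> ?T" "b \<in> ?T" "a \<noteq> b" "0 < u" "u < 1" for a b and u :: real
  proof -
    have "(1 - u) * (c v - c a) \<ge> 0" "u * (c v - c b) \<ge> 0"
      using that by auto
    moreover have "(1 - u) * (c v - c a) > 0 \<or> u * (c v - c b) > 0"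
      using that by auto
    moreover have "c ((1 - u) *\<^sub>R a + u *\<^sub>R b) = (1 - u) * c a + u * c b"
      by (simp only: add scale real_scaleR_def)
    ultimately show ?thesis
      by (auto simp: algebra_simps)
  qed
  have "convex ?T"
    unfolding convex_contains_open_segment
  proof (intro ballI subsetI)
    fix a b x assume "a \<in> ?T" "b \<in> ?T" "x \<in> open_segment a b"
    then show "x \<in> ?T"
      using comb by (auto simp: in_segment)
  qed
  then have "convex hull S \<subseteq> ?T"
    using less by (intro hull_minimal) auto
  moreover have "v \<in> convex hull S"
    using \<open>v \<in> S\<close> by (rule hull_inc)
  moreover have "v \<notin> open_segment a b" if "a \<in> ?T" "b \<in> ?T" for a b
  proof
    assume "v \<in> open_segment a b"
    then show False
      using comb[OF that] by (auto simp: in_segment)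
  qed
  ultimately show ?thesis
    unfolding extreme_point_of_def by blast
qed

lemma mem_open_segment_minus_plus:
  fixes v d :: "'a::real_vector"
  assumes "d \<noteq> 0"
  shows "v \<in> open_segment (v - d) (v + d)"
proof -
  have "v - d \<noteq> v + d"
  proof
    assume "v - d = v + d"
    then have "2 *\<^sub>R d = 0"
      by (simp add: scaleR_2 diff_eq_eq add.assoc)
    with assms show False
      by simp
  qed
  moreover have "v = (1 - 1/2) *\<^sub>R (v - d) + (1/2) *\<^sub>R (v + d)"
    by (simp add: scaleR_diff_right scaleR_add_right flip: scaleR_add_left)
  ultimately show ?thesis
    unfolding in_segment by (intro conjI exI[of _ "1/2::real"]) auto
qed

section \<open>Sums of basis vectors generating the polytope\<close>

definition vec_of :: "nat \<Rightarrow> (nat \<Rightarrow> nat) \<Rightarrow> (nat \<Rightarrow>\<^sub>0 real)" where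
  "vec_of n f = (\<Sum>i<n. std_basis (f i))"

text \<open>\<open>PiE\<close> fixes the values at \<open>n\<close> and beyond to
  \<open>undefined\<close>, so counting these functions counts the selections themselves.\<close>

definition choices :: "nat \<Rightarrow> nat \<Rightarrow> nat \<Rightarrow> (nat \<Rightarrow> nat) set" where
  "choices k s n = PiE {..<n} (lam k s)"

definition adm :: "nat \<Rightarrow> nat \<Rightarrow> nat \<Rightarrow> (nat \<Rightarrow> nat) set" where
  "adm k s n = {f \<in> choices k s n. \<forall>i. Suc i < n \<longrightarrow>
     f i \<in> lam k s (Suc i) \<longrightarrow> f (Suc i) \<in> lam k s i \<longrightarrow> f i = f (Suc i)}"

lemma finite_choices: "finite (choices k s n)"
  by (auto simp: choices_def lam_def intro!: finite_PiE)

text \<open>Taking convex hulls commutes with Minkowski sums. Hence only the points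
  \<open>vec_of n f\<close> can be extreme.\<close>

lemma P_eq_convex_hull: "P n k s = convex hull (vec_of n ` choices k s n)"
proof -
  have "(\<Sum>i<n. std_basis ` lam k s i) = vec_of n ` choices k s n"
  proof (intro equalityI subsetI)
    fix x assume "x \<in> (\<Sum>i<n. std_basis ` lam k s i)"
    then obtain y where x: "x = (\<Sum>i<n. y i)" and "\<forall>i<n. y i \<in> std_basis ` lam k s i"
      by (auto simp: set_sum_alt)
    then have "\<forall>i<n. \<exists>j. j \<in> lam k s i \<and> y i = std_basis j"
      by blast
    then obtain f where f: "\<And>i. i < n \<Longrightarrow> f i \<in> lam k s i \<and> y i = std_basis (f i)"
      by metis
    have "x = vec_of n (restrict f {..<n})"
      unfolding x vec_of_def using f by (intro sum.cong) auto
    then show "x \<in> vec_of n ` choices k s n"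
      unfolding choices_def using f by auto
  next
    fix x assume "x \<in> vec_of n ` choices k s n"
    then show "x \<in> (\<Sum>i<n. std_basis ` lam k s i)"
      by (fastforce simp: set_sum_alt vec_of_def choices_def)
  qed
  then show ?thesis
    unfolding P_def coord_simplex_def convex_hull_set_sum[symmetric] by simp
qed

section \<open>Linear functionals maximised at admissible choices\<close>

text \<open>Intervals whose indices differ by at least 2 start at least \<open>2 * s\<close> apart,
  which is no less than their length \<open>k\<close>.\<close>

lemma mem_lam_twice:
  assumes "k \<le> 2 * s" "j \<in> lam k s i" "j \<in> lam k s i'" "i < i'"
  shows "i' = Suc i"
proof (rule ccontr)
  assume "i' \<noteq> Suc i"
  then have "i + 2 \<le> i'"
    using assms by simp
  then have "s * (i + 2) \<le> s * i'"
    by (rule mult_le_mono2)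
  then show False
    using assms by (simp add: lam_def algebra_simps)
qed

text \<open>
  Walking along the intervals, the height goes up or down according to which of the chosen
  elements \<open>f i\<close>, \<open>f (i + 1)\<close> has to carry the larger weight. Admissibility says that
  at most one of the two is forced.
\<close>

primrec height :: "nat \<Rightarrow> nat \<Rightarrow> (nat \<Rightarrow> nat) \<Rightarrow> nat \<Rightarrow> real" where
  "height k s f 0 = 0"
| "height k s f (Suc i) = height k s f i +
     (if f i = f (Suc i) then 0 else if f i \<in> lam k s (Suc i) then 1 else - 1)"

lemma height_ge: "height k s f i \<ge> - real i"
  by (induction i) auto

lemma adm_imp_weight:
  assumes ks: "k \<le> 2 * s" and f: "f \<in> adm k s n"
  obtains w :: "nat \<Rightarrow> real"
  where "\<And>i j. i < n \<Longrightarrow> j \<in> lam k s i \<Longrightarrow> j \<noteq> f i \<Longrightarrow> w j < w (f i)"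
proof
  let ?h = "height k s f"
  \<comment> \<open>An element may be selected at two indices; \<open>eq\<close> below shows that
    the height does not depend on the one that \<open>inv_into\<close> returns. The shift by
    \<open>n\<close> makes the weight of every selected element positive, since the height at
    \<open>i < n\<close> is at least \<open>- real i\<close>.\<close>
  define w where "w j = (if j \<in> f ` {..<n} then n + ?h (inv_into {..<n} f j) else 0)" for j
  have mem: "f i \<in> lam k s i" if "i < n" for i
    using f that by (auto simp: adm_def choices_def)
  have adj: "f i = f (Suc i)" if "Suc i < n" "f i \<in> lam k s (Suc i)" "f (Suc i) \<in> lam k s i" for i
    using f that by (auto simp: adm_def)
  have eq: "?h i = ?h i'" if "f i = f i'" "i < i'" "i' < n" for i i'
  proof -
    have "i' = Suc i"
      using mem_lam_twice[OF ks, of "f i" i i'] mem[of i] mem[of i'] that by simp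
    then show ?thesis
      using that by simp
  qed
  have w: "w (f i) = n + ?h i" if "i < n" for i
  proof -
    have "inv_into {..<n} f (f i) < n" "f (inv_into {..<n} f (f i)) = f i"
      using that inv_into_into[of "f i" f "{..<n}"] f_inv_into_f[of "f i" f "{..<n}"] by auto
    then have "?h (inv_into {..<n} f (f i)) = ?h i"
      using eq that by (metis linorder_neqE_nat)
    then show ?thesis
      using that by (simp add: w_def)
  qed
  fix i j assume ij: "i < n" "j \<in> lam k s i" "j \<noteq> f i"
  show "w j < w (f i)"
  proof (cases "j \<in> f ` {..<n}")
    case False
    then show ?thesis
      using w[OF ij(1)] height_ge[of i k s f] ij(1) by (simp add: w_def)
  next
    case True
    then obtain i' where i': "i' < n" "j = f i'"
      by auto
    with ij have "i \<noteq> i'"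
      by auto
    then consider "i < i'" | "i' < i"
      by linarith
    then have "?h i' < ?h i"
    proof cases
      case 1
      then have [simp]: "i' = Suc i"
        using mem_lam_twice[OF ks ij(2), of i'] mem i' by simp
      \<comment> \<open>Here \<open>f (Suc i)\<close> lies in interval \<open>i\<close>, so
        admissibility keeps \<open>f i\<close> out of interval \<open>Suc i\<close> and the height
        drops. In the other case \<open>f i'\<close> lies in interval \<open>Suc i'\<close>, so the
        height rises from \<open>i'\<close> to \<open>i\<close>.\<close>
      have "f i \<notin> lam k s (Suc i)"
        using adj[of i] ij i' by auto
      then show ?thesis
        using ij i' by auto
    next
      case 2
      then have [simp]: "i = Suc i'"
        using mem_lam_twice[OF ks, of j i' i] mem i' ij by simp
      show ?thesis
        using ij i' by auto
    qed
    then show ?thesis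
      using w i' ij by simp
  qed
qed

text \<open>The functional pairs a vector with the weights \<open>w\<close>. Its value at
  \<open>vec_of n g\<close> is the sum of the weights of the \<open>g i\<close>, and
  \<open>f\<close> is the unique maximiser in each interval separately.\<close>

lemma adm_imp_functional:
  assumes ks: "k \<le> 2 * s" and f: "f \<in> adm k s n"
  obtains c :: "(nat \<Rightarrow>\<^sub>0 real) \<Rightarrow> real"
  where "linear c" "\<And>g. g \<in> choices k s n \<Longrightarrow> g \<noteq> f \<Longrightarrow> c (vec_of n g) < c (vec_of n f)"
proof -
  from adm_imp_weight[OF assms] obtain w :: "nat \<Rightarrow> real"
    where w: "\<And>i j. i < n \<Longrightarrow> j \<in> lam k s i \<Longrightarrow> j \<noteq> f i \<Longrightarrow> w j < w (f i)"
    by blast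
  define J where "J = (\<Union>i<n. lam k s i)"
  define c where "c x = (\<Sum>j\<in>J. w j * Poly_Mapping.lookup x j)" for x
  have lin: "linear c"
    by (rule linearI) (simp_all add: c_def lookup_add lookup_scaleR sum.distrib
        sum_distrib_left algebra_simps)
  have fin: "finite J"
    by (simp add: J_def lam_def)
  have c_basis: "c (std_basis j) = w j" if "j \<in> J" for j
  proof -
    have "c (std_basis j) = (\<Sum>i\<in>J. if i = j then w i else 0)"
      unfolding c_def std_basis_def by (intro sum.cong) (auto simp: lookup_single when_def)
    then show ?thesis
      using that fin by simp
  qed
  have c_vec: "c (vec_of n g) = (\<Sum>i<n. w (g i))" if "g \<in> choices k s n" for g
    unfolding vec_of_def linear_sum[OF lin] using that
    by (intro sum.cong c_basis) (auto simp: J_def choices_def)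
  have fc: "f \<in> choices k s n"
    using f by (simp add: adm_def)
  show ?thesis
  proof (rule that[OF lin])
    fix g assume g: "g \<in> choices k s n" "g \<noteq> f"
    then obtain i where i: "i < n" "g i \<noteq> f i"
      using fc unfolding choices_def by (metis PiE_ext lessThan_iff)
    have gm: "g i \<in> lam k s i" if "i < n" for i
      using g that by (auto simp: choices_def)
    have "(\<Sum>i<n. w (g i)) < (\<Sum>i<n. w (f i))"
    proof (rule sum_strict_mono_ex1)
      show "\<forall>i\<in>{..<n}. w (g i) \<le> w (f i)"
        using w gm by (metis lessThan_iff less_imp_le order_refl)
      show "\<exists>i\<in>{..<n}. w (g i) < w (f i)"
        using w gm i by (meson lessThan_iff)
    qed simp
    then show "c (vec_of n g) < c (vec_of n f)"
      using c_vec g fc by simp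
  qed
qed

text \<open>The functional for \<open>f\<close> separates \<open>f\<close> from every other choice.
  On all of \<open>choices\<close> injectivity can fail, as two selected elements of an overlap can
  be swapped.\<close>

lemma inj_on_vec_of:
  assumes "k \<le> 2 * s"
  shows "inj_on (vec_of n) (adm k s n)"
proof (rule inj_onI, rule ccontr)
  fix f g assume "f \<in> adm k s n" "g \<in> adm k s n" "vec_of n f = vec_of n g" "f \<noteq> g"
  moreover from this have "g \<in> choices k s n"
    by (simp add: adm_def)
  ultimately show False
    using adm_imp_functional[OF assms \<open>f \<in> adm k s n\<close>] by (metis less_irrefl)
qed

lemma vec_of_upd:
  assumes "i < n"
  shows "vec_of n (f(i := j)) = vec_of n f - std_basis (f i) + std_basis j"
proof -
  have "vec_of n g = std_basis (g i) + (\<Sum>i\<in>{..<n} - {i}. std_basis (g i))" for g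
    unfolding vec_of_def using assms by (intro sum.remove) auto
  from this[of f] this[of "f(i := j)"] show ?thesis
    by simp
qed

lemma std_basis_inject: "std_basis i = std_basis j \<longleftrightarrow> i = j"
  by (metis std_basis_def lookup_single_eq lookup_single_not_eq zero_neq_one)

text \<open>
  If \<open>f i \<noteq> f (i + 1)\<close> both lie in the overlap, then replacing either of them by the other
  moves the point in opposite directions.
\<close>

lemma extreme_imp_adm:
  assumes f: "f \<in> choices k s n" and ext: "vec_of n f extreme_point_of P n k s"
  shows "f \<in> adm k s n"
proof -
  have "f i = f (Suc i)" if i: "Suc i < n" "f i \<in> lam k s (Suc i)" "f (Suc i) \<in> lam k s i" for i
  proof (rule ccontr)
    assume ne: "f i \<noteq> f (Suc i)"
    let ?v = "vec_of n f" and ?d = "std_basis (f (Suc i)) - std_basis (f i)"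
    have upd: "f(i := f (Suc i)) \<in> choices k s n" "f(Suc i := f i) \<in> choices k s n"
      using f i by (auto simp: choices_def PiE_def extensional_def Pi_def)
    have "?v + ?d = vec_of n (f(i := f (Suc i)))" "?v - ?d = vec_of n (f(Suc i := f i))"
      using i by (simp_all add: vec_of_upd)
    then have "?v + ?d \<in> P n k s" "?v - ?d \<in> P n k s"
      using upd unfolding P_eq_convex_hull by (auto intro: hull_inc)
    moreover have "?v \<in> open_segment (?v - ?d) (?v + ?d)"
      using ne by (intro mem_open_segment_minus_plus) (simp add: std_basis_inject)
    ultimately show False
      using ext unfolding extreme_point_of_def by blast
  qed
  with f show ?thesis
    by (simp add: adm_def)
qed

lemma vertices_eq:
  assumes "k \<le> 2 * s"
  shows "{v. v extreme_point_of P n k s} = vec_of n ` adm k s n"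
proof (intro equalityI subsetI)
  fix v assume v: "v \<in> {v. v extreme_point_of P n k s}"
  then obtain f where "f \<in> choices k s n" "v = vec_of n f"
    unfolding P_eq_convex_hull using extreme_point_of_convex_hull by blast
  then show "v \<in> vec_of n ` adm k s n"
    using v extreme_imp_adm by blast
next
  fix v assume "v \<in> vec_of n ` adm k s n"
  then obtain f where f: "f \<in> adm k s n" "v = vec_of n f"
    by blast
  obtain c :: "(nat \<Rightarrow>\<^sub>0 real) \<Rightarrow> real" where
    "linear c" "\<And>g. g \<in> choices k s n \<Longrightarrow> g \<noteq> f \<Longrightarrow> c (vec_of n g) < c v"
    using adm_imp_functional[OF assms f(1)] f(2) by metis
  then have "v extreme_point_of P n k s"
    unfolding P_eq_convex_hull using f
    by (intro extreme_point_of_convex_hull_strict_max) (auto simp: adm_def)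
  then show "v \<in> {v. v extreme_point_of P n k s}"
    by simp
qed

lemma num_vertices_eq_card_adm:
  assumes "k \<le> 2 * s"
  shows "num_vertices k s n = card (adm k s n)"
  unfolding num_vertices_def vertices_eq[OF assms] by (rule card_image[OF inj_on_vec_of[OF assms]])

section \<open>Counting admissible choices\<close>

definition next_choices :: "nat \<Rightarrow> nat \<Rightarrow> nat \<Rightarrow> nat \<Rightarrow> nat set" where
  "next_choices k s i x =
     {j \<in> lam k s (Suc i). x \<in> lam k s (Suc i) \<longrightarrow> j \<in> lam k s i \<longrightarrow> x = j}"

lemma adm_Suc_restrict:
  assumes "f \<in> adm k s (Suc n)"
  shows "restrict f {..<n} \<in> adm k s n"
  using assms by (auto simp: adm_def choices_def)

text \<open>Admissibility only relates neighbours, so the possible extensions depend on the last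
  value alone.\<close>

lemma adm_Suc_Suc:
  "adm k s (Suc (Suc n)) = (\<lambda>(f, j). f(Suc n := j)) `
     (SIGMA f:adm k s (Suc n). next_choices k s n (f n))"
proof (intro equalityI subsetI)
  fix f assume f: "f \<in> adm k s (Suc (Suc n))"
  have "f = (restrict f {..<Suc n})(Suc n := f (Suc n))"
  proof
    fix i show "f i = ((restrict f {..<Suc n})(Suc n := f (Suc n))) i"
      using f by (auto simp: adm_def choices_def PiE_def extensional_def)
  qed
  moreover have "f (Suc n) \<in> next_choices k s n (restrict f {..<Suc n} n)"
    using f by (auto simp: adm_def choices_def next_choices_def)
  ultimately show "f \<in> (\<lambda>(f, j). f(Suc n := j)) `
     (SIGMA f:adm k s (Suc n). next_choices k s n (f n))"
    using adm_Suc_restrict[OF f] by (intro rev_image_eqI[of "(restrict f {..<Suc n}, f (Suc n))"]) auto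
next
  fix f assume "f \<in> (\<lambda>(f, j). f(Suc n := j)) `
     (SIGMA f:adm k s (Suc n). next_choices k s n (f n))"
  then show "f \<in> adm k s (Suc (Suc n))"
    by (auto simp: adm_def choices_def next_choices_def PiE_def extensional_def Pi_def less_Suc_eq)
qed

lemma finite_adm: "finite (adm k s n)"
  by (rule finite_subset[OF _ finite_choices]) (auto simp: adm_def)

lemma finite_next_choices: "finite (next_choices k s i x)"
  by (simp add: next_choices_def lam_def)

lemma inj_on_extend:
  "inj_on (\<lambda>(f, j). f(n := j)) (SIGMA f:adm k s n. X f)"
proof (rule inj_onI, clarify)
  fix f g :: "nat \<Rightarrow> nat" and i j
  assume f: "f \<in> adm k s n" and g: "g \<in> adm k s n" and eq: "f(n := i) = g(n := j)"
  have "f x = g x" for x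
  proof (cases "x = n")
    \<comment> \<open>Both functions are \<open>undefined\<close> at \<open>n\<close>, so the update
      there destroys no information.\<close>
    case True
    then show ?thesis
      using f g by (auto simp: adm_def choices_def PiE_def extensional_def)
  next
    case False
    then show ?thesis
      using fun_cong[OF eq, of x] by simp
  qed
  then show "f = g \<and> i = j"
    using fun_cong[OF eq, of n] by auto
qed

lemma card_adm_Suc_Suc:
  "card (adm k s (Suc (Suc n))) = (\<Sum>f\<in>adm k s (Suc n). card (next_choices k s n (f n)))"
  unfolding adm_Suc_Suc
  by (simp add: card_image[OF inj_on_extend] finite_adm finite_next_choices)

lemma card_adm_0: "card (adm k s 0) = 1"
  by (simp add: adm_def choices_def)

lemma card_adm_1: "card (adm k s (Suc 0)) = k"
proof -
  have "adm k s (Suc 0) = PiE {..<Suc 0} (lam k s)"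
    by (auto simp: adm_def choices_def)
  then show ?thesis
    by (simp add: card_PiE lam_def)
qed

text \<open>After an \<open>x\<close> in the overlap, only \<open>x\<close> itself and the
  \<open>s\<close> elements of the next interval outside the current one remain.\<close>

lemma card_next_choices:
  assumes "s \<le> k" "x \<in> lam k s i"
  shows "card (next_choices k s i x) = (if x \<in> lam k s (Suc i) then s + 1 else k)"
proof (cases "x \<in> lam k s (Suc i)")
  case True
  then have "next_choices k s i x = insert x {s * i + k..<s * i + k + s}"
    using assms by (auto simp: next_choices_def lam_def)
  moreover have "x \<notin> {s * i + k..<s * i + k + s}"
    using assms by (auto simp: lam_def)
  ultimately show ?thesis
    using True by simp
next
  case False
  then have "next_choices k s i x = lam k s (Suc i)"
    by (auto simp: next_choices_def)
  moreover have "card (lam k s (Suc i)) = k"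
    by (simp add: lam_def)
  ultimately show ?thesis
    using False by simp
qed

text \<open>An element of the overlap with the next interval is not in the preceding interval, so it
  can be appended to any admissible choice without constraint.\<close>

lemma card_adm_overlap:
  assumes "k \<le> 2 * s" "s \<le> k"
  shows "card {f \<in> adm k s (Suc n). f n \<in> lam k s (Suc n)} = (k - s) * card (adm k s n)"
proof -
  let ?O = "lam k s n \<inter> lam k s (Suc n)"
  let ?upd = "\<lambda>(f, j). f(n := j)"
  have "{f \<in> adm k s (Suc n). f n \<in> lam k s (Suc n)} = ?upd ` (adm k s n \<times> ?O)"
  proof (intro equalityI subsetI)
    fix f assume f: "f \<in> {f \<in> adm k s (Suc n). f n \<in> lam k s (Suc n)}"
    then have "f = (restrict f {..<n})(n := f n)"
      by (intro ext) (auto simp: adm_def choices_def PiE_def extensional_def)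
    moreover have "f n \<in> ?O"
      using f by (auto simp: adm_def choices_def)
    ultimately show "f \<in> ?upd ` (adm k s n \<times> ?O)"
      using adm_Suc_restrict[of f k s n] f
      by (intro rev_image_eqI[of "(restrict f {..<n}, f n)"]) auto
  next
    fix f assume "f \<in> ?upd ` (adm k s n \<times> ?O)"
    then obtain g j where f: "f = g(n := j)" and g: "g \<in> adm k s n" and j: "j \<in> ?O"
      by auto
    have "j \<notin> lam k s i" if "n = Suc i" for i
      using j mem_lam_twice[OF assms(1), of j i "Suc n"] that by auto
    then have "f \<in> adm k s (Suc n)"
      using g j unfolding f
      by (auto simp: adm_def choices_def PiE_def extensional_def Pi_def less_Suc_eq)
    then show "f \<in> {f \<in> adm k s (Suc n). f n \<in> lam k s (Suc n)}"
      using f j by simp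
  qed
  moreover have "?O = {s * n + s..<s * n + k}"
    using assms by (auto simp: lam_def)
  then have "card ?O = k - s"
    by simp
  ultimately show ?thesis
    by (simp add: card_image[OF inj_on_extend] card_cartesian_product)
qed

text \<open>Each choice has \<open>k\<close> extensions, except that one ending in the overlap loses
  \<open>k - (s + 1)\<close> of them; \<open>card_adm_overlap\<close> counts these
  exceptions.\<close>

lemma card_adm_recurrence:
  assumes "k \<le> 2 * s" "s \<le> k"
  shows "real (card (adm k s (Suc (Suc n)))) = real k * card (adm k s (Suc n))
    - (real k - real s) * (real k - real s - 1) * card (adm k s n)"
proof -
  let ?A = "adm k s (Suc n)"
  have "real (card (adm k s (Suc (Suc n)))) = (\<Sum>f\<in>?A. real (card (next_choices k s n (f n))))"
    by (simp add: card_adm_Suc_Suc)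
  also have "\<dots> = (\<Sum>f\<in>?A. real k - (if f n \<in> lam k s (Suc n) then real k - real s - 1 else 0))"
  proof (intro sum.cong refl)
    fix f assume "f \<in> ?A"
    then have "f n \<in> lam k s n"
      by (auto simp: adm_def choices_def)
    then show "real (card (next_choices k s n (f n)))
        = real k - (if f n \<in> lam k s (Suc n) then real k - real s - 1 else 0)"
      using assms by (simp add: card_next_choices)
  qed
  also have "\<dots> = real k * card ?A
      - (real k - real s - 1) * card {f \<in> ?A. f n \<in> lam k s (Suc n)}"
    by (simp add: sum_subtractf finite_adm flip: sum.inter_filter)
  finally show ?thesis
    using assms by (simp add: card_adm_overlap of_nat_diff)
qed

section \<open>Second-order linear recurrences\<close>

lemma second_order_recurrence_closed_form:
  fixes b :: "nat \<Rightarrow> 'a::comm_ring_1"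
  assumes "b 0 = 1" "b (Suc 0) = \<alpha> + \<beta>"
    and "\<And>n. b (Suc (Suc n)) = (\<alpha> + \<beta>) * b (Suc n) - \<alpha> * \<beta> * b n"
  shows "(\<alpha> - \<beta>) * b n = \<alpha> ^ Suc n - \<beta> ^ Suc n"
proof (induction n rule: induct_nat_012)
  case (ge2 n)
  have "(\<alpha> - \<beta>) * b (Suc (Suc n))
      = (\<alpha> + \<beta>) * ((\<alpha> - \<beta>) * b (Suc n)) - \<alpha> * \<beta> * ((\<alpha> - \<beta>) * b n)"
    unfolding assms by (simp add: algebra_simps)
  also have "\<dots> = \<alpha> ^ Suc (Suc (Suc n)) - \<beta> ^ Suc (Suc (Suc n))"
    unfolding ge2 by (simp add: algebra_simps)
  finally show ?case .
qed (use assms in \<open>simp_all add: algebra_simps\<close>)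

text \<open>The quotient \<open>b n / \<alpha> ^ n\<close> has the positive limit
  \<open>\<alpha> / (\<alpha> - \<beta>)\<close>, so its logarithm converges and vanishes after
  division by \<open>n\<close>.\<close>

lemma second_order_recurrence_growth:
  fixes b :: "nat \<Rightarrow> real"
  assumes "b 0 = 1" "b (Suc 0) = \<alpha> + \<beta>"
    and "\<And>n. b (Suc (Suc n)) = (\<alpha> + \<beta>) * b (Suc n) - \<alpha> * \<beta> * b n"
    and pos: "0 < \<beta>" "\<beta> < \<alpha>"
  shows "(\<lambda>n. ln (b n) / real n) \<longlonglongrightarrow> ln \<alpha>"
proof -
  let ?r = "\<lambda>n. b n / \<alpha> ^ n"
  have r: "?r n = (\<alpha> - \<beta> * (\<beta> / \<alpha>) ^ n) / (\<alpha> - \<beta>)" for n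
  proof -
    have "b n = (\<alpha> ^ Suc n - \<beta> ^ Suc n) / (\<alpha> - \<beta>)"
      using second_order_recurrence_closed_form[of b, OF assms(1-3), of n] pos
      by (simp add: field_simps)
    then show ?thesis
      using pos by (simp add: power_divide diff_divide_distrib)
  qed
  have b_pos: "b n > 0" for n
  proof -
    have "\<beta> ^ Suc n < \<alpha> ^ Suc n"
      using pos by (intro power_strict_mono) auto
    then have "(\<alpha> - \<beta>) * b n > 0"
      using second_order_recurrence_closed_form[of b, OF assms(1-3), of n] by simp
    then show ?thesis
      using pos by (simp add: zero_less_mult_iff)
  qed
  have "(\<lambda>n. (\<beta> / \<alpha>) ^ n) \<longlonglongrightarrow> 0"
    using pos by (intro LIMSEQ_realpow_zero) auto
  then have "?r \<longlonglongrightarrow> (\<alpha> - \<beta> * 0) / (\<alpha> - \<beta>)"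
    unfolding r using pos by (intro tendsto_intros) auto
  then have "(\<lambda>n. ln (?r n)) \<longlonglongrightarrow> ln (\<alpha> / (\<alpha> - \<beta>))"
    using pos by (intro tendsto_ln) auto
  then have "(\<lambda>n. ln (?r n) / real n) \<longlonglongrightarrow> 0"
    using filterlim_at_top_imp_at_infinity[OF filterlim_real_sequentially]
    by (rule tendsto_divide_0)
  then have "(\<lambda>n. ln (?r n) / real n + ln \<alpha>) \<longlonglongrightarrow> 0 + ln \<alpha>"
    by (intro tendsto_intros)
  \<comment> \<open>At \<open>n = 0\<close> division by zero gives 0 and the term
    \<open>ln \<alpha>\<close> would be left over, so the two sequences are compared only
    eventually.\<close>
  moreover have "ln (?r n) / real n + ln \<alpha> = ln (b n) / real n" if "n > 0" for n
    using b_pos[of n] pos that by (simp add: ln_div ln_realpow field_simps)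
  then have "\<forall>\<^sub>F n in sequentially. ln (?r n) / real n + ln \<alpha> = ln (b n) / real n"
    using eventually_gt_at_top[of 0] by (rule eventually_mono[rotated])
  ultimately show ?thesis
    by (simp add: tendsto_cong)
qed

theorem corollary4p19:
  fixes k s :: nat
  assumes "k > 0" and "s > 0"
    and "int s \<in> {\<lceil>real k / 2\<rceil>..int k - 2}"
  shows "(\<lambda>n. ln (real (num_vertices k s n)) / real n) \<longlonglongrightarrow>
    ln (2 * (real k - real s) * (real k - real s - 1) /
        (real k - sqrt ((real k)\<^sup>2 - 4 * (real k - real s) * (real k - real s - 1))))"
proof -
  have "real k / 2 \<le> of_int (int s)"
    using assms(3) by (simp only: atLeastAtMost_iff ceiling_le_iff)
  then have ks: "k \<le> 2 * s"
    by simp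
  have sk: "s + 2 \<le> k"
    using assms(3) by auto
  define m where "m = real k - real s"
  define d where "d = sqrt ((real k)\<^sup>2 - 4 * m * (m - 1))"
  define \<alpha> where "\<alpha> = (real k + d) / 2"
  define \<beta> where "\<beta> = (real k - d) / 2"
  \<comment> \<open>The first bound makes \<open>m * (m - 1)\<close>, and with it
    \<open>\<beta>\<close>, positive. The second makes the discriminant at least
    \<open>4 * m\<close>, so that the roots are real and distinct.\<close>
  have m: "2 \<le> m" "2 * m \<le> real k"
    using ks sk by (simp_all add: m_def)
  have "(2 * m)\<^sup>2 \<le> (real k)\<^sup>2"
    using m by (intro power_mono) auto
  then have disc: "(real k)\<^sup>2 - 4 * m * (m - 1) > 0"
    using m by (simp add: power2_eq_square algebra_simps)
  then have d_sq: "d\<^sup>2 = (real k)\<^sup>2 - 4 * m * (m - 1)"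
    by (simp add: d_def)
  have "\<alpha> * \<beta> = ((real k)\<^sup>2 - d\<^sup>2) / 4"
    by (simp add: \<alpha>_def \<beta>_def power2_eq_square field_simps)
  then have prod: "\<alpha> * \<beta> = m * (m - 1)"
    unfolding d_sq by simp
  have "d > 0"
    using disc by (simp add: d_def)
  then have "\<beta> < \<alpha>" "\<alpha> > 0"
    using \<open>k > 0\<close> by (simp_all add: \<alpha>_def \<beta>_def)
  moreover have "\<beta> > 0"
  proof -
    have "\<alpha> * \<beta> > 0"
      using m unfolding prod by simp
    with \<open>\<alpha> > 0\<close> show ?thesis
      by (simp add: zero_less_mult_iff)
  qed
  moreover have "2 * m * (m - 1) / (real k - d) = \<alpha>"
  proof -
    have "real k - d = 2 * \<beta>"
      by (simp add: \<beta>_def)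
    with prod \<open>\<beta> > 0\<close> show ?thesis
      by (simp add: field_simps)
  qed
  moreover have "(\<lambda>n. ln (real (num_vertices k s n)) / real n) \<longlonglongrightarrow> ln \<alpha>"
  proof (rule second_order_recurrence_growth)
    have sum: "\<alpha> + \<beta> = real k"
      by (simp add: \<alpha>_def \<beta>_def field_simps)
    show "real (num_vertices k s 0) = 1" "real (num_vertices k s (Suc 0)) = \<alpha> + \<beta>"
      unfolding num_vertices_eq_card_adm[OF ks] sum by (simp_all add: card_adm_0 card_adm_1)
    show "real (num_vertices k s (Suc (Suc n))) =
        (\<alpha> + \<beta>) * real (num_vertices k s (Suc n)) - \<alpha> * \<beta> * real (num_vertices k s n)" for n
      unfolding num_vertices_eq_card_adm[OF ks] sum prod
      using card_adm_recurrence[OF ks, of n] sk by (simp add: m_def)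
  qed fact+
  ultimately show ?thesis
    by (simp add: m_def d_def)
qed

end
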